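(* Let $q$ be a prime power, let $t\ge 2$ and $m\ge 1$ be integers, and let $h_0,\ldots,h_{m-1}$ be integers with $h_i\ge 1$ for $0\le i\le m-1$ and $h_0=\min\{h_i:0\le i\le m-1\}$. If there exists a $k$-parc $\mathcal{K}$ in $\Pi_{t-1}(q)$, with pencil $\Psi_0,\ldots,\Psi_q$ and $h_i=|\mathcal{K}\cap\Psi_i|$ for $0\le i\le m-1$, having $k=h_0+h_1+\cdots+h_{m-1}$ points, then there exists an ideal secret sharing scheme of parallel model with $k-h_0$ participants and of strength $t$.
   Context: Projective geometry. $\Pi_r(q)$ is the projective space of dimension $r$ over $GF(q)$. Points are (linearly) independent if vectors representing them are linearly independent. A $k$-arc in $\Pi_r(q)$ is a set of $k$ points any $r+1$ of which are independent. A pencil in $\Pi_r(q)$ is the set of all $q+1$ hyperplanes $\Psi_0,\ldots,\Psi_q$ of $\Pi_r(q)$ containing a given common subspace of dimension $r-2$. A $k$-parc (pencil arc) in $\Pi_r(q)$ with pencil $\Psi_0,\ldots,\Psi_q$ is a set $\mathcal{K}$ of $k$ points of $\Pi_r(q)$ such that: (a) for $0\le i\le q$, $\mathcal{K}\cap\Psi_i$ is an $h_i$-arc in the $(r-1)$-dimensional projective space $\Psi_i$, where $h_i=|\mathcal{K}\cap\Psi_i|$; (b) $\mathcal{K}\cap\Psi_i\cap\Psi_j=\emptyset$ for $i\ne j$; (c) any $r+1$ points of $\mathcal{K}$ not contained in any single $\Psi_i$ are independent. Secret sharing. Given finite sets $\mathcal{K}_0$ (keys), $\mathcal{S}$ (shares),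 $\mathcal{P}$ (participants) and a dealer $D\notin\mathcal{P}$, an access structure $\Gamma$ is a monotone (upward closed) family of subsets of $\mathcal{P}$; it is determined by its basis $\Gamma^*$, the set of its minimal members. A perfect secret sharing scheme realizing $\Gamma$ is represented by an array $M$ with rows indexed by a finite nonempty set $\mathcal{F}$ and columns indexed by $\{D\}\cup\mathcal{P}$, entries $M(f,D)\in\mathcal{K}_0$, $M(f,P)\in\mathcal{S}$, and $M(f,B)=(M(f,P):P\in B)$, such that: (1) if $B\in\Gamma$ and $M(f,B)=M(f',B)$ then $M(f,D)=M(f',D)$; (2) for any $B\subseteq\mathcal{P}$ with $B\notin\Gamma$ and any $f\in\mathcal{F}$, the number $|\{g\in\mathcal{F}:M(g,D)=K,\ M(g,B)=M(f,B)\}|$ is the same for every $K\in\mathcal{K}_0$. It is ideal if the information rate $\log_2|\mathcal{K}_0|/\log_2|\mathcal{S}|$ equals $1$ (so $|\mathcal{K}_0|=|\mathcal{S}|\ge2$). Parallel model of strength $t$: $\mathcal{P}$ is partitioned into mutually disjoint groups $G_1,\ldots,G_n$ and $\Gamma^*=\binom{\mathcal{P}}{t}\setminus\bigcup_{i=1}^n\binom{G_i}{t}$, i.e. the minimal authorized subsets are exactly the $t$-subsets of $\mathcal{P}$ not included in any single group. A scheme of parallel model of strength $t$ is a scheme realizing such an access structure. *)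

theory Defs
  imports "HOL-Analysis.Analysis" "HOL-Number_Theory.Prime_Powers"
begin

section \<open>Projective geometry\<close>

text \<open>
  The space \<open>\<Pi>\<^sub>r(q)\<close> is the lattice of linear subspaces of \<open>'a ^ 'n\<close>, where \<open>'a\<close> is a finite field
  with \<open>q = CARD('a)\<close> elements and \<open>r = CARD('n) - 1\<close>. Dimensions are projective and
  integer-valued; the empty projective subspace (the zero vector space) has dimension \<open>-1\<close>.
  A point is a line through the origin, and it lies on a subspace \<open>U\<close> iff it is a subset of \<open>U\<close>.
\<close>

definition proj_subspace :: "int \<Rightarrow> ('a::field ^ 'n) set \<Rightarrow> bool" where
  "proj_subspace d U \<longleftrightarrow> vec.subspace U \<and> int (vec.dim U) = d + 1"

definition space_dim :: "('a::field ^ 'n) itself \<Rightarrow> int" where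
  "space_dim _ = int CARD('n) - 1"

definition hyperplane :: "('a::field ^ 'n) set \<Rightarrow> bool" where
  "hyperplane H \<longleftrightarrow> proj_subspace (space_dim TYPE('a ^ 'n) - 1) H"

definition points_on :: "('a::field ^ 'n) set \<Rightarrow> ('a ^ 'n) set set" where
  "points_on U = {p. proj_subspace 0 p \<and> p \<subseteq> U}"

definition represents :: "'a::field ^ 'n \<Rightarrow> ('a ^ 'n) set \<Rightarrow> bool" where
  "represents v p \<longleftrightarrow> v \<noteq> 0 \<and> p = vec.span {v}"

text \<open>
  Distinct points have distinct representatives, so independence of the set \<open>v ` B\<close> is
  independence of the family; the choice of representatives is immaterial.
\<close>

definition points_independent :: "('a::field ^ 'n) set set \<Rightarrow> bool" where
  "points_independent B \<longleftrightarrow> (\<exists>v. (\<forall>p\<in>B. represents (v p) p) \<and> vec.independent (v ` B))"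

definition arc_in :: "('a::field ^ 'n) set \<Rightarrow> int \<Rightarrow> nat \<Rightarrow> ('a ^ 'n) set set \<Rightarrow> bool" where
  "arc_in U d k A \<longleftrightarrow>
     proj_subspace d U \<and> A \<subseteq> points_on U \<and> finite A \<and> card A = k \<and>
     (\<forall>B\<subseteq>A. int (card B) = d + 1 \<longrightarrow> points_independent B)"

text \<open>\<open>\<Psi> 0, \<dots>, \<Psi> q\<close> enumerate the pencil without repetition; values beyond \<open>q\<close> are irrelevant.\<close>

definition pencil :: "(nat \<Rightarrow> ('a::{field,finite} ^ 'n) set) \<Rightarrow> bool" where
  "pencil \<Psi> \<longleftrightarrow>
     (\<exists>V. proj_subspace (space_dim TYPE('a ^ 'n) - 2) V \<and>
          bij_betw \<Psi> {0..CARD('a)} {H. hyperplane H \<and> V \<subseteq> H})"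

definition parc ::
  "nat \<Rightarrow> (nat \<Rightarrow> ('a::{field,finite} ^ 'n) set) \<Rightarrow> ('a ^ 'n) set set \<Rightarrow> bool" where
  "parc k \<Psi> \<K> \<longleftrightarrow>
     pencil \<Psi> \<and> \<K> \<subseteq> points_on UNIV \<and> finite \<K> \<and> card \<K> = k \<and>
     (\<forall>i\<in>{0..CARD('a)}.
        arc_in (\<Psi> i) (space_dim TYPE('a ^ 'n) - 1)
          (card (\<K> \<inter> points_on (\<Psi> i))) (\<K> \<inter> points_on (\<Psi> i))) \<and>
     (\<forall>i\<in>{0..CARD('a)}. \<forall>j\<in>{0..CARD('a)}. i \<noteq> j \<longrightarrow>
        \<K> \<inter> points_on (\<Psi> i) \<inter> points_on (\<Psi> j) = {}) \<and>
     (\<forall>B\<subseteq>\<K>. int (card B) = space_dim TYPE('a ^ 'n) + 1 \<and>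
        (\<forall>i\<in>{0..CARD('a)}. \<not> B \<subseteq> points_on (\<Psi> i)) \<longrightarrow> points_independent B)"

section \<open>Secret sharing\<close>

definition access_structure :: "'p set \<Rightarrow> 'p set set \<Rightarrow> bool" where
  "access_structure P \<Gamma> \<longleftrightarrow>
     \<Gamma> \<subseteq> Pow P \<and> (\<forall>A B. A \<in> \<Gamma> \<and> A \<subseteq> B \<and> B \<subseteq> P \<longrightarrow> B \<in> \<Gamma>)"

definition access_basis :: "'p set set \<Rightarrow> 'p set set" where
  "access_basis \<Gamma> = {A \<in> \<Gamma>. \<forall>B\<in>\<Gamma>. B \<subseteq> A \<longrightarrow> B = A}"

text \<open>\<open>M(f,B) = M(g,B)\<close>\<close>

definition agree_on :: "('f \<Rightarrow> 'p \<Rightarrow> 'v) \<Rightarrow> 'f \<Rightarrow> 'f \<Rightarrow> 'p set \<Rightarrow> bool" where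
  "agree_on M f g B \<longleftrightarrow> (\<forall>x\<in>B. M f x = M g x)"

definition perfect_scheme ::
  "'v set \<Rightarrow> 'v set \<Rightarrow> 'p set \<Rightarrow> 'p \<Rightarrow> 'f set \<Rightarrow> ('f \<Rightarrow> 'p \<Rightarrow> 'v) \<Rightarrow> 'p set set \<Rightarrow> bool" where
  "perfect_scheme \<K>\<^sub>0 \<S> P D F M \<Gamma> \<longleftrightarrow>
     finite \<K>\<^sub>0 \<and> finite \<S> \<and> finite P \<and> D \<notin> P \<and> finite F \<and> F \<noteq> {} \<and>
     access_structure P \<Gamma> \<and>
     (\<forall>f\<in>F. M f D \<in> \<K>\<^sub>0 \<and> (\<forall>x\<in>P. M f x \<in> \<S>)) \<and>
     (\<forall>B\<in>\<Gamma>. \<forall>f\<in>F. \<forall>g\<in>F. agree_on M f g B \<longrightarrow> M f D = M g D) \<and>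
     (\<forall>B\<subseteq>P. B \<notin> \<Gamma> \<longrightarrow> (\<forall>f\<in>F. \<forall>K\<in>\<K>\<^sub>0. \<forall>L\<in>\<K>\<^sub>0.
        card {g\<in>F. M g D = K \<and> agree_on M g f B} =
        card {g\<in>F. M g D = L \<and> agree_on M g f B}))"

text \<open>
  Since division by zero yields zero, rate \<open>1\<close> forces both sets to have the same cardinality,
  at least \<open>2\<close>.
\<close>

definition information_rate :: "'v set \<Rightarrow> 'v set \<Rightarrow> real" where
  "information_rate \<K>\<^sub>0 \<S> = log 2 (real (card \<K>\<^sub>0)) / log 2 (real (card \<S>))"

definition ideal_scheme ::
  "'v set \<Rightarrow> 'v set \<Rightarrow> 'p set \<Rightarrow> 'p \<Rightarrow> 'f set \<Rightarrow> ('f \<Rightarrow> 'p \<Rightarrow> 'v) \<Rightarrow> 'p set set \<Rightarrow> bool" where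
  "ideal_scheme \<K>\<^sub>0 \<S> P D F M \<Gamma> \<longleftrightarrow>
     perfect_scheme \<K>\<^sub>0 \<S> P D F M \<Gamma> \<and> information_rate \<K>\<^sub>0 \<S> = 1"

definition subsets_of_size :: "'p set \<Rightarrow> nat \<Rightarrow> 'p set set" where
  "subsets_of_size A t = {B. B \<subseteq> A \<and> finite B \<and> card B = t}"

definition parallel_model ::
  "nat \<Rightarrow> 'p set \<Rightarrow> nat \<Rightarrow> (nat \<Rightarrow> 'p set) \<Rightarrow> 'p set set \<Rightarrow> bool" where
  "parallel_model t P n G \<Gamma> \<longleftrightarrow>
     access_structure P \<Gamma> \<and>
     (\<Union>i\<in>{1..n}. G i) = P \<and> (\<forall>i\<in>{1..n}. G i \<noteq> {}) \<and> disjoint_family_on G {1..n} \<and>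
     access_basis \<Gamma> = subsets_of_size P t - (\<Union>i\<in>{1..n}. subsets_of_size (G i) t)"

end

theory Submission
  imports Defs
begin

text \<open>
  Fix a point \<open>d\<close> of the parc on \<open>\<Psi> 0\<close> for the dealer and let the participants be the points of the
  parc on \<open>\<Psi> 1, \<dots>, \<Psi> (m - 1)\<close>, grouped by hyperplane. The array is the linear one: its rows are all
  vectors \<open>f\<close>, and the entry in the column of a point represented by \<open>x\<close> is the scalar product of
  \<open>f\<close> and \<open>x\<close>. Such an array realizes the structure in which a set of participants is authorized iff
  the span of its representatives contains that of the dealer (\<open>linear_ideal_scheme\<close>): if the
  dealer's vector lies outside the span, some \<open>w\<close> is orthogonal to the span but not to the
  dealer's vector, and translation by multiples of \<open>w\<close> permutes the rows compatible with the given
  shares while it shifts the key.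

  It remains to compare spans. A \<open>t\<close>-set of participants in no single group is a basis by the parc
  axioms, so it spans \<open>d\<close>. A set inside one group spans a subspace of the corresponding \<open>\<Psi> i\<close>, which
  misses \<open>d\<close> because \<open>\<Psi> 0\<close> and \<open>\<Psi> i\<close> share no point of the parc. A set of fewer than \<open>t\<close>
  participants that lies in no single group can be enlarged, together with \<open>d\<close>, to \<open>t\<close> points of the
  parc, which again form a basis, so \<open>d\<close> is not in its span. The enlargement needs \<open>t \<le> k\<close>; when
  \<open>k < t\<close> no set is authorized, and giving every participant the zero vector suffices.
\<close>

section \<open>Linear secret sharing schemes\<close>

text \<open>The standard bilinear form on \<open>'a ^ 'n\<close>, for coordinates in an arbitrary field.\<close>

definition scalar_prod :: "'a::field ^ 'n \<Rightarrow> 'a ^ 'n \<Rightarrow> 'a" where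
  "scalar_prod u x = (\<Sum>i\<in>UNIV. u $ i * x $ i)"

lemma scalar_prod_add_left: "scalar_prod (u + w) x = scalar_prod u x + scalar_prod w x"
  by (simp add: scalar_prod_def distrib_right sum.distrib)

lemma scalar_prod_scale_left: "scalar_prod (c *s u) x = c * scalar_prod u x"
  by (simp add: scalar_prod_def sum_distrib_left mult.assoc)

lemma scalar_prod_scale_right: "scalar_prod u (c *s x) = c * scalar_prod u x"
  by (simp add: scalar_prod_def sum_distrib_left mult_ac)

lemma scalar_prod_add_right: "scalar_prod u (x + y) = scalar_prod u x + scalar_prod u y"
  by (simp add: scalar_prod_def distrib_left sum.distrib)

lemma scalar_prod_eq_on_span:
  assumes "x \<in> vec.span S" and "\<And>s. s \<in> S \<Longrightarrow> scalar_prod u s = scalar_prod w s"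
  shows "scalar_prod u x = scalar_prod w x"
  using assms(1)
proof (induction rule: vec.span_induct_alt)
  case base
  show ?case by (simp add: scalar_prod_def)
next
  case (step c s y)
  then show ?case by (simp add: scalar_prod_add_right scalar_prod_scale_right assms(2))
qed

text \<open>
  The functional that kills \<open>S\<close> and maps \<open>x\<close> to \<open>1\<close> is read off from a linear endomorphism that
  fixes \<open>x\<close> and kills a basis of the span of \<open>S\<close>: take a coordinate in which \<open>x\<close> is nonzero.
\<close>

lemma separating_vector:
  fixes x :: "'a::field ^ 'n"
  assumes "x \<notin> vec.span S"
  obtains w where "\<And>s. s \<in> S \<Longrightarrow> scalar_prod w s = 0" and "scalar_prod w x = 1"
proof -
  obtain C where C: "C \<subseteq> S" "vec.independent C" "S \<subseteq> vec.span C"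
    using vec.maximal_independent_subset by blast
  have x: "x \<notin> vec.span C" using assms C(1) vec.span_mono by blast
  then have "vec.independent (insert x C)" using C(2) by (simp add: vec.independent_insert)
  then obtain g :: "'a ^ 'n \<Rightarrow> 'a ^ 'n" where g: "Vector_Spaces.linear (*s) (*s) g"
    "\<forall>y\<in>insert x C. g y = (if y = x then x else 0)"
    using vec.linear_independent_extend[of "insert x C" "\<lambda>y. if y = x then x else 0"] by auto
  have "x \<noteq> 0" using x vec.span_zero by blast
  then obtain j where j: "x $ j \<noteq> 0" by (auto simp: vec_eq_iff)
  define w where "w = (\<chi> i. matrix g $ j $ i / x $ j)"
  have w: "scalar_prod w y = g y $ j / x $ j" for y
  proof -
    have "g y = matrix g *v y" using g(1) by (simp add: matrix_works)
    then show ?thesis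
      by (simp add: w_def scalar_prod_def matrix_vector_mult_def sum_divide_distrib)
  qed
  have "scalar_prod w s = 0" if "s \<in> S" for s
  proof -
    have "scalar_prod w c = scalar_prod 0 c" if "c \<in> C" for c
      using that g(2) x vec.span_base[of c C] unfolding w by (auto simp: scalar_prod_def)
    then have "scalar_prod w s = scalar_prod 0 s"
      using scalar_prod_eq_on_span[of s C w 0] C(3) that by blast
    then show ?thesis by (simp add: scalar_prod_def)
  qed
  moreover have "scalar_prod w x = 1" using g(2) j by (simp add: w)
  ultimately show thesis by (rule that)
qed

lemma linear_perfect_scheme:
  fixes v :: "'p \<Rightarrow> 'a::{field,finite} ^ 'n"
  assumes "finite P" "D \<notin> P" "access_structure P \<Gamma>"
    and auth: "\<And>B. B \<in> \<Gamma> \<Longrightarrow> v D \<in> vec.span (v ` B)"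
    and unauth: "\<And>B. B \<subseteq> P \<Longrightarrow> B \<notin> \<Gamma> \<Longrightarrow> v D \<notin> vec.span (v ` B)"
  shows "perfect_scheme UNIV UNIV P D UNIV (\<lambda>f x. scalar_prod f (v x)) \<Gamma>"
proof -
  let ?M = "\<lambda>f x. scalar_prod f (v x)"
  have key: "?M f D = ?M g D" if "B \<in> \<Gamma>" "agree_on ?M f g B" for B f g
    using scalar_prod_eq_on_span[OF auth[OF that(1)], of f g] that(2) by (auto simp: agree_on_def)
  have uniform: "card {g. ?M g D = K \<and> agree_on ?M g f B} = card {g. ?M g D = L \<and> agree_on ?M g f B}"
    if B: "B \<subseteq> P" "B \<notin> \<Gamma>" for B f K L
  proof -
    obtain w where w: "\<And>s. s \<in> v ` B \<Longrightarrow> scalar_prod w s = 0" "scalar_prod w (v D) = 1"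
      using separating_vector[OF unauth[OF B]] by blast
    \<comment> \<open>Adding \<open>(L - K) *s w\<close> to a row keeps the shares of \<open>B\<close> and turns the key \<open>K\<close> into \<open>L\<close>.\<close>
    have undo: "g + (K' - L') *s w + (L' - K') *s w = g" for g K' L'
      by (simp add: vec_eq_iff algebra_simps)
    have "bij_betw (\<lambda>g. g + (L - K) *s w) {g. ?M g D = K \<and> agree_on ?M g f B}
        {g. ?M g D = L \<and> agree_on ?M g f B}"
      by (rule bij_betwI[where g = "\<lambda>g. g + (K - L) *s w"])
        (auto simp: agree_on_def scalar_prod_add_left scalar_prod_scale_left w undo
          simp del: vector_sub_rdistrib vec.scale_left_diff_distrib)
    then show ?thesis by (rule bij_betw_same_card)
  qed
  show ?thesis
    unfolding perfect_scheme_def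
  proof (intro conjI ballI allI impI)
    fix B f g assume "B \<in> \<Gamma>" "agree_on ?M f g B"
    then show "?M f D = ?M g D" by (rule key)
  next
    fix B f K L assume "B \<subseteq> P" "B \<notin> \<Gamma>"
    then show "card {g \<in> UNIV. ?M g D = K \<and> agree_on ?M g f B} =
        card {g \<in> UNIV. ?M g D = L \<and> agree_on ?M g f B}"
      using uniform by simp
  qed (simp_all add: assms(1-3))
qed

text \<open>Rows and entries may be renamed injectively; the participants stay as they are.\<close>

lemma perfect_scheme_to_nat:
  fixes M :: "'f::countable \<Rightarrow> 'p \<Rightarrow> 'v::countable"
  assumes M: "perfect_scheme \<K>\<^sub>0 \<S> P D F M \<Gamma>"
  shows "perfect_scheme (to_nat ` \<K>\<^sub>0) (to_nat ` \<S>) P D (to_nat ` F)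
    (\<lambda>f x. to_nat (M (from_nat f) x)) \<Gamma>"
proof -
  let ?N = "\<lambda>f x. to_nat (M (from_nat f) x)"
  have eq: "{g \<in> to_nat ` F. ?N g D = to_nat K \<and> agree_on ?N g (to_nat f) B}
      = to_nat ` {g \<in> F. M g D = K \<and> agree_on M g f B}" for K f B
    by (auto simp: agree_on_def)
  have card_eq: "card {g \<in> to_nat ` F. ?N g D = to_nat K \<and> agree_on ?N g (to_nat f) B}
      = card {g \<in> F. M g D = K \<and> agree_on M g f B}" for K f B
    unfolding eq by (intro card_image inj_on_subset[OF inj_to_nat]) simp
  have key: "\<forall>B\<in>\<Gamma>. \<forall>f\<in>F. \<forall>g\<in>F. agree_on M f g B \<longrightarrow> M f D = M g D"
    and uniform: "\<forall>B\<subseteq>P. B \<notin> \<Gamma> \<longrightarrow> (\<forall>f\<in>F. \<forall>K\<in>\<K>\<^sub>0. \<forall>L\<in>\<K>\<^sub>0.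
      card {g \<in> F. M g D = K \<and> agree_on M g f B} = card {g \<in> F. M g D = L \<and> agree_on M g f B})"
    and rest: "finite \<K>\<^sub>0" "finite \<S>" "finite P" "D \<notin> P" "finite F" "F \<noteq> {}" "access_structure P \<Gamma>"
      "\<forall>f\<in>F. M f D \<in> \<K>\<^sub>0 \<and> (\<forall>x\<in>P. M f x \<in> \<S>)"
    using M unfolding perfect_scheme_def by - (elim conjE, assumption)+
  have agree: "agree_on ?N (to_nat f) (to_nat g) B \<longleftrightarrow> agree_on M f g B" for f g B
    by (simp add: agree_on_def)
  show ?thesis
    unfolding perfect_scheme_def
  proof (intro conjI ballI allI impI)
    fix B f g
    assume "B \<in> \<Gamma>" "f \<in> to_nat ` F" "g \<in> to_nat ` F" "agree_on ?N f g B"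
    moreover from this obtain f' g' where "f' \<in> F" "g' \<in> F" "f = to_nat f'" "g = to_nat g'"
      by blast
    ultimately show "?N f D = ?N g D" using key by (simp add: agree)
  next
    fix B f K L
    assume B: "B \<subseteq> P" "B \<notin> \<Gamma>" and "f \<in> to_nat ` F" "K \<in> to_nat ` \<K>\<^sub>0" "L \<in> to_nat ` \<K>\<^sub>0"
    then obtain f' K' L' where f: "f' \<in> F" "K' \<in> \<K>\<^sub>0" "L' \<in> \<K>\<^sub>0"
      and eqs: "f = to_nat f'" "K = to_nat K'" "L = to_nat L'" by blast
    show "card {g \<in> to_nat ` F. ?N g D = K \<and> agree_on ?N g f B} =
        card {g \<in> to_nat ` F. ?N g D = L \<and> agree_on ?N g f B}"
      unfolding eqs card_eq using uniform B f by blast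
  qed (use rest in auto)
qed

lemma linear_ideal_scheme:
  fixes v :: "'p \<Rightarrow> 'a::{field,finite} ^ 'n"
  assumes "finite P" "D \<notin> P" "access_structure P \<Gamma>"
    and "\<And>B. B \<in> \<Gamma> \<Longrightarrow> v D \<in> vec.span (v ` B)"
    and "\<And>B. B \<subseteq> P \<Longrightarrow> B \<notin> \<Gamma> \<Longrightarrow> v D \<notin> vec.span (v ` B)"
  shows "\<exists>(\<K>\<^sub>0 :: nat set) (\<S> :: nat set) (F :: nat set) (M :: nat \<Rightarrow> 'p \<Rightarrow> nat).
    ideal_scheme \<K>\<^sub>0 \<S> P D F M \<Gamma>"
proof -
  have "2 \<le> CARD('a)"
    using card_mono[of "UNIV :: 'a set" "{0, 1}"] by simp
  then have "0 < log 2 (real CARD('a))" by simp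
  then have "log 2 (real CARD('a)) \<noteq> 0" by linarith
  then have "information_rate (range (to_nat :: 'a \<Rightarrow> nat)) (range (to_nat :: 'a \<Rightarrow> nat)) = 1"
    by (simp add: information_rate_def card_image)
  then show ?thesis
    unfolding ideal_scheme_def
    using perfect_scheme_to_nat[OF linear_perfect_scheme[OF assms]] by blast
qed

section \<open>The access structure of the parallel model\<close>

text \<open>
  The sets of at least \<open>t\<close> participants that lie in no single group. When the groups partition the
  finite set \<open>P\<close> and \<open>2 \<le> t\<close>, this is the upward closed family generated by the basis in the
  parallel model.
\<close>

definition parallel_structure :: "nat \<Rightarrow> 'p set \<Rightarrow> nat \<Rightarrow> (nat \<Rightarrow> 'p set) \<Rightarrow> 'p set set" where
  "parallel_structure t P n G = {B. B \<subseteq> P \<and> t \<le> card B \<and> (\<forall>i\<in>{1..n}. \<not> B \<subseteq> G i)}"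

text \<open>
  Two members from different groups already witness that a set lies in no group; here \<open>2 \<le> t\<close>
  is needed.
\<close>

lemma parallel_structure_contains_minimal:
  assumes "2 \<le> t" "finite P" "(\<Union>i\<in>{1..n}. G i) = P" "disjoint_family_on G {1..n}"
    and B: "B \<in> parallel_structure t P n G"
  obtains A where "A \<subseteq> B" "A \<in> parallel_structure t P n G" "card A = t"
proof -
  have BP: "B \<subseteq> P" "t \<le> card B" and nB: "\<And>i. i \<in> {1..n} \<Longrightarrow> \<not> B \<subseteq> G i"
    using B by (auto simp: parallel_structure_def)
  then have "B \<noteq> {}" using assms(1) by auto
  then obtain b i where b: "b \<in> B" "i \<in> {1..n}" "b \<in> G i" using BP(1) assms(3) by blast
  obtain c where c: "c \<in> B" "c \<notin> G i" using nB[OF b(2)] by blast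
  have fB: "finite B" using BP(1) assms(2) finite_subset by blast
  have "card {b, c} \<le> t" using assms(1) by (simp add: card_insert_if)
  then obtain A where A: "{b, c} \<subseteq> A" "A \<subseteq> B" "card A = t"
    using exists_subset_between[of "{b, c}" t B] BP(2) b(1) c(1) fB by auto
  have "\<not> A \<subseteq> G j" if j: "j \<in> {1..n}" for j
  proof
    assume "A \<subseteq> G j"
    then have "j = i" using A(1) b assms(4) j unfolding disjoint_family_on_def by blast
    then show False using \<open>A \<subseteq> G j\<close> A(1) c(2) by blast
  qed
  then show thesis using that[of A] A BP(1) by (auto simp: parallel_structure_def)
qed

lemma access_structure_parallel_structure:
  assumes "finite P"
  shows "access_structure P (parallel_structure t P n G)"
proof -
  have "t \<le> card B" if "A \<subseteq> B" "B \<subseteq> P" "t \<le> card A" for A B :: "'a set"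
    using that card_mono[of B A] finite_subset[of B P] assms by auto
  then show ?thesis
    unfolding access_structure_def parallel_structure_def by blast
qed

lemma parallel_model_parallel_structure:
  assumes "2 \<le> t" "finite P" "(\<Union>i\<in>{1..n}. G i) = P" "disjoint_family_on G {1..n}"
    and "\<forall>i\<in>{1..n}. G i \<noteq> {}"
  shows "parallel_model t P n G (parallel_structure t P n G)"
proof -
  let ?\<Gamma> = "parallel_structure t P n G"
  have basis: "A \<in> access_basis ?\<Gamma> \<longleftrightarrow> A \<in> ?\<Gamma> \<and> card A = t" for A
  proof
    assume A: "A \<in> access_basis ?\<Gamma>"
    then have "A \<in> ?\<Gamma>" by (simp add: access_basis_def)
    then obtain C where "C \<subseteq> A" "C \<in> ?\<Gamma>" "card C = t"
      using parallel_structure_contains_minimal[OF assms(1-4)] by blast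
    then show "A \<in> ?\<Gamma> \<and> card A = t" using A by (auto simp: access_basis_def)
  next
    assume A: "A \<in> ?\<Gamma> \<and> card A = t"
    then have "finite A" using assms(2) finite_subset by (auto simp: parallel_structure_def)
    then have "B = A" if "B \<in> ?\<Gamma>" "B \<subseteq> A" for B
      using that A card_seteq[of A B] by (auto simp: parallel_structure_def)
    then show "A \<in> access_basis ?\<Gamma>" using A by (auto simp: access_basis_def)
  qed
  have "access_basis ?\<Gamma> = {A \<in> ?\<Gamma>. card A = t}" using basis by blast
  also have "\<dots> = subsets_of_size P t - (\<Union>i\<in>{1..n}. subsets_of_size (G i) t)"
    using finite_subset[OF _ assms(2)]
    by (auto simp: parallel_structure_def subsets_of_size_def)
  finally have "access_basis ?\<Gamma> = subsets_of_size P t - (\<Union>i\<in>{1..n}. subsets_of_size (G i) t)" .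
  then show ?thesis
    using assms access_structure_parallel_structure[OF assms(2)] by (simp add: parallel_model_def)
qed

section \<open>Representatives of points\<close>

text \<open>
  A fixed choice of representative. The choice made in the definition of independence may
  differ from set to set; the lemmas below compare spans only, which do not depend on it.
\<close>

definition rep :: "('a::field ^ 'n) set \<Rightarrow> 'a ^ 'n" where
  "rep p = (SOME v. represents v p)"

lemma represents_rep:
  assumes "proj_subspace 0 p"
  shows "represents (rep p) p"
proof -
  have p: "vec.subspace p" "vec.dim p = 1" using assms by (auto simp: proj_subspace_def)
  obtain b where b: "b \<subseteq> p" "vec.independent b" "p \<subseteq> vec.span b" "card b = vec.dim p"
    using vec.basis_exists by blast
  then obtain v where v: "b = {v}" using p(2) by (auto simp: card_1_singleton_iff)
  have "v \<noteq> 0" using b(2) v vec.dependent_zero by blast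
  moreover have "p = vec.span {v}"
    using b v p(1) vec.span_minimal by blast
  ultimately have "represents v p" by (simp add: represents_def)
  then show ?thesis unfolding rep_def by (rule someI)
qed

lemma rep_in_subspace_iff:
  assumes "proj_subspace 0 p" "vec.subspace U"
  shows "rep p \<in> U \<longleftrightarrow> p \<subseteq> U"
  using represents_rep[OF assms(1)] vec.span_base[of "rep p" "{rep p}"]
    vec.span_minimal[of "{rep p}" U] assms(2)
  by (auto simp: represents_def)

lemma span_rep_eq_UNIV:
  fixes B :: "('a::field ^ 'n) set set"
  assumes B: "B \<subseteq> points_on UNIV" "card B = CARD('n)" and ind: "points_independent B"
  shows "vec.span (rep ` B) = UNIV"
proof -
  obtain v where v: "\<And>p. p \<in> B \<Longrightarrow> represents (v p) p" "vec.independent (v ` B)"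
    using ind by (auto simp: points_independent_def)
  have "inj_on v B"
    by (rule inj_onI) (metis v(1) represents_def)
  then have "card (v ` B) = CARD('n)" using B(2) by (simp add: card_image)
  then have UNIV: "UNIV \<subseteq> vec.span (v ` B)"
    using vec.card_ge_dim_independent[OF _ v(2), of UNIV] by (simp add: vec.dim_UNIV card_cart_basis)
  have "v ` B \<subseteq> vec.span (rep ` B)"
  proof (rule image_subsetI)
    fix p assume p: "p \<in> B"
    have "proj_subspace 0 p" using B(1) p by (auto simp: points_on_def)
    moreover have "rep p \<in> vec.span (rep ` B)" using p by (intro vec.span_base) blast
    ultimately have "p \<subseteq> vec.span (rep ` B)" using rep_in_subspace_iff vec.subspace_span by blast
    then show "v p \<in> vec.span (rep ` B)"
      using v(1)[OF p] vec.span_base by (auto simp: represents_def)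
  qed
  then show ?thesis using UNIV vec.span_minimal[OF _ vec.subspace_span] by blast
qed

text \<open>
  Were \<open>rep d\<close> in the span of the others, fewer than \<open>CARD('n)\<close> vectors would span the whole space.
\<close>

lemma rep_notin_span_of_fewer:
  fixes A :: "('a::field ^ 'n) set set"
  assumes A: "A \<subseteq> points_on UNIV" "card A = CARD('n)" "points_independent A"
    and "insert d B \<subseteq> A" "d \<notin> B"
  shows "rep d \<notin> vec.span (rep ` B)"
proof
  assume "rep d \<in> vec.span (rep ` B)"
  moreover have "vec.span (rep ` B) \<subseteq> vec.span (rep ` (A - {d}))"
    using assms(4,5) by (intro vec.span_mono) blast
  ultimately have "rep d \<in> vec.span (rep ` (A - {d}))" by blast
  then have "rep ` A \<subseteq> vec.span (rep ` (A - {d}))"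
    using vec.span_base[of _ "rep ` (A - {d})"] by blast
  then have "vec.span (rep ` A) \<subseteq> vec.span (rep ` (A - {d}))"
    by (rule vec.span_minimal) (rule vec.subspace_span)
  then have "UNIV \<subseteq> vec.span (rep ` (A - {d}))" using span_rep_eq_UNIV[OF A] by simp
  moreover have fin: "finite A" using A(2) card.infinite by fastforce
  ultimately have "vec.dim (UNIV :: ('a ^ 'n) set) \<le> card (rep ` (A - {d}))"
    by (intro vec.dim_le_card) auto
  also have "\<dots> \<le> card (A - {d})" by (rule card_image_le) (simp add: fin)
  also have "\<dots> < card A" using assms(4) fin by (intro card_Diff1_less) auto
  finally show False using A(2) by (simp add: vec.dim_UNIV card_cart_basis)
qed

section \<open>The scheme of a parc\<close>

theorem theorem4p1:
  fixes \<K> :: "('a::{field,finite} ^ 'n) set set"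
    and \<Psi> :: "nat \<Rightarrow> ('a ^ 'n) set"
    and q t m k :: nat and h :: "nat \<Rightarrow> nat"
  assumes "primepow q" and "CARD('a) = q"
    and "t \<ge> 2" and "CARD('n) = t"
    and "1 \<le> m" and "m \<le> q + 1"
    and "\<forall>i<m. h i \<ge> 1"
    and "h 0 = Min (h ` {..<m})"
    and "parc k \<Psi> \<K>"
    and "\<forall>i<m. h i = card (\<K> \<inter> points_on (\<Psi> i))"
    and "k = (\<Sum>i<m. h i)"
  shows "\<exists>(\<K>\<^sub>0 :: nat set) (\<S> :: nat set) (P :: nat set) (D :: nat) (F :: nat set)
           (M :: nat \<Rightarrow> nat \<Rightarrow> nat) (\<Gamma> :: nat set set) (n :: nat) (G :: nat \<Rightarrow> nat set).
           ideal_scheme \<K>\<^sub>0 \<S> P D F M \<Gamma> \<and> parallel_model t P n G \<Gamma> \<and> card P = k - h 0 \<and>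
           n = m - 1 \<and> (\<forall>i\<in>{1..n}. card (G i) = h i)"
proof -
  define n where "n = m - 1"
  \<comment> \<open>\<open>L i\<close> and \<open>Q\<close> are sets of points; \<open>G i\<close> and \<open>P\<close> are the corresponding sets of numbers.\<close>
  define L where "L i = \<K> \<inter> points_on (\<Psi> i)" for i
  define Q where "Q = (\<Union>i\<in>{1..n}. L i)"
  define e :: "('a ^ 'n) set \<Rightarrow> nat" where "e = to_nat"
  define G where "G i = e ` L i" for i
  define P where "P = (\<Union>i\<in>{1..n}. G i)"
  define \<Gamma> where "\<Gamma> = parallel_structure t P n G"
  have inj_e: "inj_on e A" for A unfolding e_def by (rule inj_on_subset[OF inj_to_nat]) simp
  have e_inv: "from_nat (e p) = p" for p by (simp add: e_def)
  have e_eq [simp]: "e p = e p' \<longleftrightarrow> p = p'" for p p' by (simp add: e_def)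
  have e_sub: "e ` A \<subseteq> e ` B \<longleftrightarrow> A \<subseteq> B" for A B by auto
  have idx: "i \<in> {0..CARD('a)}" if "i < m" for i using that assms(2,6) by auto
  have L: "L i \<subseteq> \<K>" for i by (auto simp: L_def)
  have pc: "\<K> \<subseteq> points_on UNIV" "finite \<K>" "card \<K> = k"
    using assms(9) by (auto simp: parc_def)
  have pt: "proj_subspace 0 p" if "p \<in> \<K>" for p using pc(1) that by (auto simp: points_on_def)
  have sub: "vec.subspace (\<Psi> i)" if "i < m" for i
    using assms(9) idx[OF that] by (auto simp: parc_def arc_in_def proj_subspace_def)
  have meet: "p \<in> \<K> \<Longrightarrow> p \<in> points_on (\<Psi> i) \<Longrightarrow> p \<in> points_on (\<Psi> j) \<Longrightarrow> i = j"
    if "i \<in> {0..CARD('a)}" "j \<in> {0..CARD('a)}" for i j p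
    using assms(9) that unfolding parc_def by blast
  have disj: "L i \<inter> L j = {}" if "i < m" "j < m" "i \<noteq> j" for i j
    using meet[OF idx[OF that(1)] idx[OF that(2)]] that(3) by (auto simp: L_def)
  have indep: "points_independent B"
    if "B \<subseteq> \<K>" "card B = t" "\<And>i. i \<in> {0..CARD('a)} \<Longrightarrow> \<not> B \<subseteq> points_on (\<Psi> i)" for B
    using assms(4,9) that by (auto simp: parc_def space_dim_def)
  have h: "h i = card (L i)" if "i < m" for i using assms(10) that by (simp add: L_def)
  have Lne: "L i \<noteq> {}" if "i < m" for i
    using h[OF that] assms(7) that by fastforce
  have lt: "i < m" if "i \<in> {1..n}" for i using that assms(5) by (auto simp: n_def)
  have m0: "0 < m" using assms(5) by simp
  obtain d where d: "d \<in> L 0" using Lne[OF m0] by blast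
  have dK: "d \<in> \<K>" using d L by blast
  have QK: "Q \<subseteq> \<K>" using L by (auto simp: Q_def)
  have PQ: "P = e ` Q" by (auto simp: P_def Q_def G_def)
  have finP: "finite P" using PQ QK pc(2) finite_subset by blast
  have dL: "d \<notin> L i" if "i \<in> {1..n}" for i
    using d disj[OF m0 lt[OF that]] that by auto
  have dP: "e d \<notin> P" using dL by (auto simp: PQ Q_def)
  have disjG: "disjoint_family_on G {1..n}"
    unfolding disjoint_family_on_def
  proof (intro ballI impI)
    fix i j assume "i \<in> {1..n}" "j \<in> {1..n}" "i \<noteq> j"
    then have "L i \<inter> L j = {}" using disj lt by blast
    then show "G i \<inter> G j = {}" by (auto simp: G_def)
  qed
  note parallel = assms(3) finP P_def[symmetric] disjG
  have model: "parallel_model t P n G \<Gamma>"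
    unfolding \<Gamma>_def
    using Lne[OF lt] by (intro parallel_model_parallel_structure[OF parallel]) (simp add: G_def)
  have cardG: "card (G i) = h i" if "i \<in> {1..n}" for i
    using h[OF lt[OF that]] by (simp add: G_def card_image[OF inj_e])
  have "card P = k - h 0"
  proof -
    have "card P = card Q" by (simp add: PQ card_image[OF inj_e])
    also have "\<dots> = (\<Sum>i\<in>{1..n}. card (L i))"
      unfolding Q_def using disj[OF lt lt] finite_subset[OF L pc(2)]
      by (intro card_UN_disjoint) auto
    also have "\<dots> = (\<Sum>i\<in>{1..n}. h i)" using h[OF lt] by (intro sum.cong) auto
    also have "\<dots> = k - h 0"
    proof -
      have "{..<m} = insert 0 {1..n}" using m0 by (auto simp: n_def)
      then show ?thesis by (simp add: assms(11))
    qed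
    finally show ?thesis .
  qed
  \<comment> \<open>A point of the parc lies on at most one member of the pencil, so for a set that meets a group
    it suffices to compare with that group, even for the members \<open>\<Psi> i\<close> with \<open>m \<le> i\<close>.\<close>
  have not_in_member: "\<not> B \<subseteq> points_on (\<Psi> i)"
    if "B \<subseteq> \<K>" "b \<in> B" "j < m" "b \<in> L j" "\<not> B \<subseteq> L j" "i \<in> {0..CARD('a)}" for B b i j
  proof
    assume *: "B \<subseteq> points_on (\<Psi> i)"
    then have "i = j" using meet[OF that(6) idx[OF that(3)], of b] that by (auto simp: L_def)
    then show False using * that by (auto simp: L_def)
  qed
  have "access_structure P \<Gamma>"
    using access_structure_parallel_structure[OF finP] by (simp add: \<Gamma>_def)
  have "\<exists>(\<K>\<^sub>0 :: nat set) (\<S> :: nat set) (F :: nat set) (M :: nat \<Rightarrow> nat \<Rightarrow> nat).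
    ideal_scheme \<K>\<^sub>0 \<S> P (e d) F M \<Gamma>"
  proof (cases "t \<le> k")
    case True
    define v where "v x = rep (from_nat x :: ('a ^ 'n) set)" for x
    have v_e: "v ` e ` B = rep ` B" "v (e p) = rep p" for B p
      by (simp_all add: v_def e_inv image_image)
    show ?thesis
    proof (rule linear_ideal_scheme[of P "e d" \<Gamma> v])
      fix B assume "B \<in> \<Gamma>"
      then obtain A where A: "A \<subseteq> B" "A \<in> \<Gamma>" "card A = t"
        using parallel_structure_contains_minimal[OF parallel] unfolding \<Gamma>_def by blast
      then obtain A' where A': "A = e ` A'" "A' \<subseteq> Q"
        by (auto simp: \<Gamma>_def parallel_structure_def PQ subset_image_iff)
      have "card A' = t" using A(3) A'(1) by (simp add: card_image[OF inj_e])
      have nA: "\<not> A' \<subseteq> L i" if "i \<in> {1..n}" for i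
        using A(2) that unfolding \<Gamma>_def parallel_structure_def A'(1) G_def e_sub by blast
      have "A' \<noteq> {}" using \<open>card A' = t\<close> assms(3) by auto
      then obtain a j where a: "a \<in> A'" "j \<in> {1..n}" "a \<in> L j"
        using A'(2) unfolding Q_def by blast
      have AK: "A' \<subseteq> \<K>" using A'(2) QK by blast
      have "points_independent A'"
        using indep[OF AK \<open>card A' = t\<close>] not_in_member[OF AK a(1) lt[OF a(2)] a(3) nA[OF a(2)]]
        by blast
      then have "vec.span (rep ` A') = UNIV"
        using AK pc(1) \<open>card A' = t\<close> assms(4) by (intro span_rep_eq_UNIV) auto
      moreover have "vec.span (rep ` A') \<subseteq> vec.span (v ` B)"
        using image_mono[OF A(1), of v] by (intro vec.span_mono) (simp add: A'(1) v_e)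
      ultimately show "v (e d) \<in> vec.span (v ` B)" by blast
    next
      fix B assume "B \<subseteq> P" "B \<notin> \<Gamma>"
      then obtain B' where B': "B = e ` B'" "B' \<subseteq> Q" by (auto simp: PQ subset_image_iff)
      have BK: "B' \<subseteq> \<K>" using B'(2) QK by blast
      have "rep d \<notin> vec.span (rep ` B')"
      proof (cases "\<exists>i\<in>{1..n}. B' \<subseteq> L i")
        case True
        then obtain i where i: "i \<in> {1..n}" "B' \<subseteq> L i" by blast
        have "rep ` B' \<subseteq> \<Psi> i"
          using i(2) rep_in_subspace_iff[OF pt sub[OF lt[OF i(1)]]]
          by (auto simp: L_def points_on_def)
        then have "vec.span (rep ` B') \<subseteq> \<Psi> i"
          using sub[OF lt[OF i(1)]] by (rule vec.span_minimal)
        moreover have "rep d \<notin> \<Psi> i"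
          using dL[OF i(1)] dK pt[OF dK] rep_in_subspace_iff[OF pt[OF dK] sub[OF lt[OF i(1)]]]
          by (auto simp: L_def points_on_def)
        ultimately show ?thesis by blast
      next
        case False
        have "\<not> t \<le> card B"
          using False \<open>B \<subseteq> P\<close> \<open>B \<notin> \<Gamma>\<close>
          by (auto simp: \<Gamma>_def parallel_structure_def B'(1) G_def e_sub)
        then have "card B' < t" using B'(1) by (simp add: card_image[OF inj_e])
        show ?thesis
        \<comment> \<open>The empty set gets here when there are no groups at all.\<close>
        proof (cases "B' = {}")
          case True
          then show ?thesis using represents_rep[OF pt[OF dK]] by (auto simp: represents_def)
        next
          case nonempty: False
          then obtain b j where b: "b \<in> B'" "j \<in> {1..n}" "b \<in> L j"
            using B'(2) unfolding Q_def by blast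
          have dB: "d \<notin> B'" using B'(2) dL by (auto simp: Q_def)
          have "card (insert d B') \<le> t" using \<open>card B' < t\<close> by (simp add: card_insert_if dB)
          then obtain A where A: "insert d B' \<subseteq> A" "A \<subseteq> \<K>" "card A = t"
            using exists_subset_between[of "insert d B'" t \<K>] True pc(2,3) BK dK by auto
          have "points_independent A"
            using indep[OF A(2,3)] not_in_member[OF A(2) _ lt[OF b(2)] b(3)] A(1) b(1) dL[OF b(2)]
            by blast
          then show ?thesis
            using A pc(1) assms(4) dB by (intro rep_notin_span_of_fewer[of A d B']) auto
        qed
      qed
      then show "v (e d) \<notin> vec.span (v ` B)" by (simp add: B'(1) v_e)
    qed fact+
  next
    case False
    \<comment> \<open>All shares are \<open>0\<close>, which is compatible with every key.\<close>
    have "card P < t" using False \<open>card P = k - h 0\<close> by simp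
    then have "\<not> t \<le> card B" if "B \<subseteq> P" for B
      using card_mono[OF finP that] by linarith
    then have "\<Gamma> = {}" unfolding \<Gamma>_def parallel_structure_def by blast
    define v where "v x = (if x = e d then rep d else 0)" for x
    show ?thesis
    proof (rule linear_ideal_scheme[of P "e d" \<Gamma> v])
      fix B assume "B \<subseteq> P" "B \<notin> \<Gamma>"
      then have "v x = 0" if "x \<in> B" for x using that dP unfolding v_def by auto
      then have "vec.span (v ` B) \<subseteq> {0}"
        by (intro vec.span_minimal vec.subspace_single_0) blast
      then show "v (e d) \<notin> vec.span (v ` B)"
        using represents_rep[OF pt[OF dK]] by (auto simp: v_def represents_def)
    qed (use finP dP \<open>access_structure P \<Gamma>\<close> \<open>\<Gamma> = {}\<close> in auto)
  qed
  then obtain \<K>\<^sub>0 \<S> F :: "nat set" and M :: "nat \<Rightarrow> nat \<Rightarrow> nat"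
    where "ideal_scheme \<K>\<^sub>0 \<S> P (e d) F M \<Gamma>" by (elim exE)
  moreover have "\<forall>i\<in>{1..n}. card (G i) = h i" using cardG by blast
  ultimately show ?thesis
    using model \<open>card P = k - h 0\<close> n_def by (intro exI conjI)
qed

end
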